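(* Let $p,N\ge1$. There exist a Lipschitz differentiability space $(X,d,\mathfrak m)$ satisfying $\theta_N^+(x)>0$ for $\mathfrak m$-a.e. $x\in X$, and a function $u\in\mathrm{Lip}_b(X,d)$, such that $$\limsup_{\lambda\to+\infty}\lambda^p(\mathfrak m\times\mathfrak m)(E_{\lambda,u})=+\infty\quad\text{while}\quad\int_X\theta_N^+(x)\,(\mathrm{Lip}(u)(x))^p\,d\mathfrak m(x)<+\infty,$$ where $$E_{\lambda,u}:=\Big\{(x,y)\in X\times X:\ x\ne y,\ |u(x)-u(y)|\ge\lambda\, d(x,y)^{\frac Np+1}\Big\}.$$
   Context: A metric measure space $(X,d,\mathfrak m)$ is a non-empty complete separable metric space $(X,d)$ with a Radon measure $\mathfrak m$ such that $0<\mathfrak m(U)<+\infty$ for every non-empty bounded open set $U\subset X$. $B_r(x):=\{y\in X: d(x,y)<r\}$. For $u:X\to\mathbb R$: $\mathrm{Lip}(u)(x):=\limsup_{r\to0^+}\sup_{y\in B_r(x)}\frac{|u(y)-u(x)|}{r}$. $\mathrm{Lip}(X,d)$ is the set of (globally) Lipschitz functions $u:X\to\mathbb R$, and $\mathrm{Lip}_b(X,d)$ the subset of those with bounded support. Upper density: $\theta_N^+(x):=\limsup_{r\to0^+}\frac{\mathfrak m(B_r(x))}{r^N}\in[0,+\infty]$. Convention: $0\cdot\infty=\infty\cdot0=0$. Lipschitz differentiability space: a chart of dimension $n\in\{0,1,2,\dots\}$ is a pair $(U,\phi)$ with $U\subset X$ Borel and $\phi:X\to\mathbb R^n$ Lipschitz.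 A function $u:X\to\mathbb R$ is differentiable at $x_0\in U$ with respect to $(U,\phi)$ if there is a unique $d_{x_0}u\in\mathbb R^n$ with $\limsup_{x\to x_0}\frac{|u(x)-u(x_0)-d_{x_0}u\cdot(\phi(x)-\phi(x_0))|}{d(x,x_0)}=0$. A metric measure space is a Lipschitz differentiability space if $X$ has a countable decomposition into charts (of possibly different dimensions) such that every $u\in\mathrm{Lip}(X,d)$ is differentiable at $\mathfrak m$-a.e. point of each chart. *)

theory Defs
  imports "HOL-Analysis.Analysis"
begin

definition radon_measure_on :: "'a topology \<Rightarrow> 'a measure \<Rightarrow> bool" where
  "radon_measure_on T m \<longleftrightarrow>
     space m = topspace T \<and>
     sets m = sigma_sets (topspace T) {U. openin T U} \<and>
     (\<forall>x\<in>topspace T. \<exists>U. openin T U \<and> x \<in> U \<and> emeasure m U < \<infinity>) \<and>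
     (\<forall>B\<in>sets m. emeasure m B = (SUP K\<in>{K. compactin T K \<and> K \<subseteq> B}. emeasure m K))"

text \<open>
  The carrier of a metric space is a set, not a type. A separable metric space has
  at most the cardinality of the continuum, so every metric measure space is isometric
  to one whose carrier is a subset of the reals, with an arbitrary metric; quantifying over
  \<^typ>\<open>real metric\<close> therefore covers all metric measure spaces.
\<close>

definition metric_measure_space :: "'a metric \<Rightarrow> 'a measure \<Rightarrow> bool" where
  "metric_measure_space X m \<longleftrightarrow>
     mspace X \<noteq> {} \<and> mcomplete_of X \<and> separable_space (mtopology_of X) \<and>
     radon_measure_on (mtopology_of X) m \<and>
     (\<forall>U. openin (mtopology_of X) U \<and> U \<noteq> {} \<and> Metric_space.mbounded (mspace X) (mdist X) U
        \<longrightarrow> 0 < emeasure m U \<and> emeasure m U < \<infinity>)"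

definition pointwise_lip :: "'a metric \<Rightarrow> ('a \<Rightarrow> real) \<Rightarrow> 'a \<Rightarrow> ennreal" where
  "pointwise_lip X u x =
     Limsup (at_right 0) (\<lambda>r. SUP y\<in>mball_of X x r. ennreal (\<bar>u y - u x\<bar> / r))"

abbreviation lipschitz_fun :: "'a metric \<Rightarrow> ('a \<Rightarrow> real) \<Rightarrow> bool" where
  "lipschitz_fun X u \<equiv> Lipschitz_continuous_map X euclidean_metric u"

definition lipschitz_bounded_support :: "'a metric \<Rightarrow> ('a \<Rightarrow> real) \<Rightarrow> bool" where
  "lipschitz_bounded_support X u \<longleftrightarrow>
     lipschitz_fun X u \<and>
     Metric_space.mbounded (mspace X) (mdist X)
       (mtopology_of X closure_of {x \<in> mspace X. u x \<noteq> 0})"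

definition upper_density :: "'a metric \<Rightarrow> 'a measure \<Rightarrow> real \<Rightarrow> 'a \<Rightarrow> ennreal" where
  "upper_density X m N x =
     Limsup (at_right 0) (\<lambda>r. emeasure m (mball_of X x r) / ennreal (r powr N))"

text \<open>
  The space \<open>R^n\<close> is the carrier of \<^term>\<open>Euclidean_space n\<close>: real sequences that vanish
  from index \<open>n\<close> on. For \<open>n = 0\<close> it is a single point.
\<close>

definition chart :: "'a metric \<Rightarrow> nat \<Rightarrow> 'a set \<Rightarrow> ('a \<Rightarrow> nat \<Rightarrow> real) \<Rightarrow> bool" where
  "chart X n U \<phi> \<longleftrightarrow>
     U \<in> sigma_sets (mspace X) {V. openin (mtopology_of X) V} \<and>
     \<phi> \<in> mspace X \<rightarrow> topspace (Euclidean_space n) \<and>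
     (\<exists>L. \<forall>x\<in>mspace X. \<forall>y\<in>mspace X.
        L2_set (\<lambda>i. \<phi> x i - \<phi> y i) {..<n} \<le> L * mdist X x y)"

text \<open>
  The upper limit of the nonnegative difference quotient is taken in \<^typ>\<open>ennreal\<close>, where the
  supremum of the empty set is \<open>0\<close>. At an isolated point the condition is thus vacuous and
  only the uniqueness of the differential matters, so that functions are differentiable there
  exactly with respect to charts of dimension \<open>0\<close>.
\<close>

definition differentiable_wrt ::
  "'a metric \<Rightarrow> nat \<Rightarrow> ('a \<Rightarrow> nat \<Rightarrow> real) \<Rightarrow> ('a \<Rightarrow> real) \<Rightarrow> 'a \<Rightarrow> bool" where
  "differentiable_wrt X n \<phi> u x0 \<longleftrightarrow>
     (\<exists>!v. v \<in> topspace (Euclidean_space n) \<and>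
        Limsup (atin (mtopology_of X) x0)
          (\<lambda>x. ennreal (\<bar>u x - u x0 - (\<Sum>i<n. v i * (\<phi> x i - \<phi> x0 i))\<bar> / mdist X x x0)) = 0)"

definition lipschitz_differentiability_space :: "'a metric \<Rightarrow> 'a measure \<Rightarrow> bool" where
  "lipschitz_differentiability_space X m \<longleftrightarrow>
     metric_measure_space X m \<and>
     (\<exists>(U :: nat \<Rightarrow> 'a set) (n :: nat \<Rightarrow> nat) (\<phi> :: nat \<Rightarrow> 'a \<Rightarrow> nat \<Rightarrow> real).
        disjoint_family U \<and> (\<Union>i. U i) = mspace X \<and>
        (\<forall>i. chart X (n i) (U i) (\<phi> i)) \<and>
        (\<forall>u. lipschitz_fun X u \<longrightarrow>
           (\<forall>i. AE x in m. x \<in> U i \<longrightarrow> differentiable_wrt X (n i) (\<phi> i) u x)))"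

definition E_set :: "'a metric \<Rightarrow> real \<Rightarrow> real \<Rightarrow> ('a \<Rightarrow> real) \<Rightarrow> real \<Rightarrow> ('a \<times> 'a) set" where
  "E_set X p N u l =
     {(x, y) \<in> mspace X \<times> mspace X. x \<noteq> y \<and> \<bar>u x - u y\<bar> \<ge> l * mdist X x y powr (N / p + 1)}"

definition ennreal_powr :: "ennreal \<Rightarrow> real \<Rightarrow> ennreal" where
  "ennreal_powr a p = (if a = \<infinity> then \<infinity> else ennreal (enn2real a powr p))"

end

(* In a discrete space Lip u vanishes identically, so by 0 * \<infinity> = 0 the gradient side is 0, although
   the upper density is infinite at every atom. The space consists of the pairs of points k and
   k + d_k, with masses 2^-k, d_k = 8^-k / 2, and the distance capped at 1; u(k) = 0 and
   u(k + d_k) = d_k. At \<lambda> = d_k^(-N/p) the k-th pair belongs to E, which contributes at least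
   d_k^(-N) 4^-k \<ge> 2^k. *)

theory Submission
  imports Defs
begin

section \<open>Discrete metric measure spaces\<close>

lemma mtopology_of_eq_discrete_topology:
  assumes "\<And>x. x \<in> mspace X \<Longrightarrow> \<exists>e>0. mball_of X x e = {x}"
  shows "mtopology_of X = discrete_topology (mspace X)"
proof -
  interpret Metric_space "mspace X" "mdist X" by simp
  have "openin (mtopology_of X) {x}" if "x \<in> mspace X" for x
    using assms[OF that] unfolding mball_of_def mtopology_of_def by (metis openin_mball)
  then have "discrete_topology (mspace X) = mtopology_of X"
    by (subst discrete_topology_unique) auto
  then show ?thesis by simp
qed

text \<open>A countable set is the increasing union of the finite initial segments of an
  enumeration, so continuity from below applies. Since compact sets of a discrete space are the
  finite ones, this is the inner regularity asked of a Radon measure.\<close>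

lemma emeasure_inner_regular_finite:
  assumes "countable B" and "sets M = Pow S" and "B \<subseteq> S"
  shows "emeasure M B = (SUP K\<in>{K. finite K \<and> K \<subseteq> B}. emeasure M K)"
proof (cases "B = {}")
  case True
  then have "{K. finite K \<and> K \<subseteq> B} = {{}}" by auto
  with True show ?thesis by simp
next
  case False
  \<comment> \<open>\<open>from_nat_into\<close> enumerates non-empty countable sets, repeating
    elements of finite ones; hence the separate treatment of the empty set.\<close>
  define A where "A n = from_nat_into B ` {..n}" for n
  have sub: "A n \<subseteq> B" for n
    using from_nat_into[OF False] by (auto simp: A_def)
  have "(\<Union>n. A n) = range (from_nat_into B)"
    by (auto simp: A_def)
  then have U: "(\<Union>n. A n) = B"
    using range_from_nat_into[OF False assms(1)] by simp
  have "(SUP n. emeasure M (A n)) = emeasure M (\<Union>n. A n)"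
  proof (rule SUP_emeasure_incseq)
    show "range A \<subseteq> sets M" using sub assms by auto
    show "incseq A" by (auto simp: A_def incseq_def)
  qed
  then have "emeasure M B = (SUP n. emeasure M (A n))"
    using U by simp
  also have "\<dots> \<le> (SUP K\<in>{K. finite K \<and> K \<subseteq> B}. emeasure M K)"
    using sub by (intro SUP_mono) (auto simp: A_def)
  finally have le: "emeasure M B \<le> (SUP K\<in>{K. finite K \<and> K \<subseteq> B}. emeasure M K)" .
  have "(SUP K\<in>{K. finite K \<and> K \<subseteq> B}. emeasure M K) \<le> emeasure M B"
    using assms by (intro SUP_least emeasure_mono) auto
  with le show ?thesis by (rule antisym)
qed

lemma sigma_sets_Pow: "sigma_sets S (Pow S) = Pow S"
  using sigma_algebra.sigma_sets_eq[OF sigma_algebra_Pow] .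

text \<open>Every subset is open, so positivity on open sets comes down to positive atoms, while
  finite total mass gives both local finiteness and the upper bound on bounded sets.\<close>

lemma discrete_metric_measure_space:
  assumes top: "mtopology_of X = discrete_topology (mspace X)"
    and "countable (mspace X)" and "mspace X \<noteq> {}" and "mcomplete_of X"
    and m: "sets m = Pow (mspace X)"
    and pos: "\<And>x. x \<in> mspace X \<Longrightarrow> 0 < emeasure m {x}"
    and fin: "emeasure m (mspace X) < \<infinity>"
  shows "metric_measure_space X m"
proof -
  have sp: "space m = mspace X"
    using sets_eq_imp_space_eq[of m "count_space (mspace X)"] m by simp
  have finA: "emeasure m A < \<infinity>" if "A \<subseteq> mspace X" for A
    using emeasure_mono[of A "mspace X" m] that m fin by (auto intro: le_less_trans)
  have eq: "Collect (openin (discrete_topology (mspace X))) = Pow (mspace X)" by auto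
  have radon: "radon_measure_on (mtopology_of X) m"
    unfolding radon_measure_on_def top
  proof (intro conjI ballI)
    fix B assume "B \<in> sets m"
    then have B: "B \<subseteq> mspace X" using m by auto
    then have "{K. compactin (discrete_topology (mspace X)) K \<and> K \<subseteq> B} = {K. finite K \<and> K \<subseteq> B}"
      by (auto simp: compactin_discrete_topology)
    then show "emeasure m B
        = (SUP K\<in>{K. compactin (discrete_topology (mspace X)) K \<and> K \<subseteq> B}. emeasure m K)"
      using emeasure_inner_regular_finite[OF _ m B] countable_subset[OF B assms(2)] by simp
  next
    fix x assume "x \<in> topspace (discrete_topology (mspace X))"
    then show "\<exists>U. openin (discrete_topology (mspace X)) U \<and> x \<in> U \<and> emeasure m U < \<infinity>"
      using fin by (intro exI[of _ "mspace X"]) auto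
  qed (simp_all add: sp m eq sigma_sets_Pow)
  have posU: "0 < emeasure m U" if U: "U \<subseteq> mspace X" "U \<noteq> {}" for U
  proof -
    obtain x where "x \<in> U" using U by auto
    then show ?thesis
      using pos[of x] emeasure_mono[of "{x}" U m] U m by (auto intro: less_le_trans)
  qed
  show ?thesis
    unfolding metric_measure_space_def
  proof (intro conjI allI impI)
    show "separable_space (mtopology_of X)"
      using assms(2) by (simp add: top separable_space_discrete_topology)
    fix U assume "openin (mtopology_of X) U \<and> U \<noteq> {} \<and> Metric_space.mbounded (mspace X) (mdist X) U"
    then show "0 < emeasure m U" "emeasure m U < \<infinity>"
      using posU finA by (simp_all add: top)
  qed (use assms(3,4) radon in simp_all)
qed

text \<open>Punctured neighbourhoods in a discrete space generate the trivial filter, along which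
  the upper limit is \<open>0\<close>; uniqueness of the differential is free because the
  zero-dimensional Euclidean space is a single point.\<close>

lemma differentiable_wrt_dim_0:
  assumes "mtopology_of X = discrete_topology (mspace X)"
  shows "differentiable_wrt X 0 \<phi> u x"
proof -
  have "atin (mtopology_of X) x = bot"
    by (cases "x \<in> mspace X") (auto simp: assms trivial_limit_def eventually_atin intro: exI[of _ "{x}"])
  moreover have "topspace (Euclidean_space 0) = {\<lambda>_. 0}"
    by (auto simp: topspace_Euclidean_space)
  ultimately show ?thesis
    unfolding differentiable_wrt_def by (auto simp: bot_ennreal)
qed

text \<open>A single chart of dimension 0 covers the space; the remaining members of the sequence of
  charts are empty.\<close>

lemma discrete_lipschitz_differentiability_space:
  assumes mms: "metric_measure_space X m"
    and top: "mtopology_of X = discrete_topology (mspace X)"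
  shows "lipschitz_differentiability_space X m"
proof -
  define U where "U i = (if i = 0 then mspace X else {})" for i :: nat
  have "chart X 0 (U i) (\<lambda>_ _. 0)" for i
    unfolding chart_def
    by (auto simp: top U_def topspace_Euclidean_space L2_set_def sigma_sets.Empty sigma_sets_top
        intro: exI[of _ 0])
  moreover have "disjoint_family U" "(\<Union>i. U i) = mspace X"
    by (auto simp: U_def disjoint_family_on_def)
  ultimately show ?thesis
    unfolding lipschitz_differentiability_space_def
    using mms differentiable_wrt_dim_0[OF top]
    by (intro conjI exI[of _ U] exI[of _ "\<lambda>_. 0"] exI[of _ "\<lambda>_ _ _. 0"]) auto
qed

text \<open>For radii below \<open>e\<close> the ball contains only its centre, where the difference
  quotient is 0.\<close>

lemma pointwise_lip_isolated:
  assumes "e > 0" and "mball_of X x e = {x}"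
  shows "pointwise_lip X u x = 0"
proof -
  interpret Metric_space "mspace X" "mdist X" by simp
  have x: "x \<in> mspace X"
    using assms(2) by (metis insertI1 in_mball_of)
  have "(SUP y\<in>mball_of X x r. ennreal (\<bar>u y - u x\<bar> / r)) = 0" if r: "0 < r" "r < e" for r
  proof -
    have "mball_of X x r \<subseteq> mball_of X x e"
      using r by (auto simp: in_mball_of)
    then have "mball_of X x r = {x}"
      using assms(2) x r by (auto simp: in_mball_of)
    then show ?thesis by simp
  qed
  then have "eventually (\<lambda>r. (SUP y\<in>mball_of X x r. ennreal (\<bar>u y - u x\<bar> / r)) = 0) (at_right 0)"
    using assms(1) by (intro eventually_at_rightI[of 0 e]) auto
  from Limsup_eq[OF this] show ?thesis
    unfolding pointwise_lip_def by (simp add: Limsup_const)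
qed

text \<open>For radii below 1 the denominator is at most 1, so the density ratio is bounded below by
  the mass of the atom.\<close>

lemma upper_density_pos_atom:
  assumes "x \<in> mspace X" and "sets m = Pow (mspace X)" and "0 < emeasure m {x}" and "0 \<le> N"
  shows "0 < upper_density X m N x"
proof -
  have "emeasure m {x} \<le> emeasure m (mball_of X x r) / ennreal (r powr N)"
    if r: "0 < r" "r < 1" for r
  proof -
    have sub: "mball_of X x r \<subseteq> mspace X" "x \<in> mball_of X x r"
      using assms r by (auto simp: Metric_space.mdist_zero[OF Metric_space_mspace_mdist])
    have "r powr N \<le> 1" using r assms(4) by (simp add: powr_le1)
    then have "emeasure m {x} * ennreal (r powr N) \<le> emeasure m {x} * 1"
      by (intro mult_left_mono) auto
    also have "\<dots> \<le> emeasure m (mball_of X x r)"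
      using sub assms(2) by (auto intro!: emeasure_mono)
    finally have "emeasure m {x} * ennreal (r powr N) / ennreal (r powr N)
        \<le> emeasure m (mball_of X x r) / ennreal (r powr N)"
      by (rule divide_right_mono_ennreal)
    then show ?thesis
      using r by (simp add: ennreal_mult_divide_eq)
  qed
  then have "eventually (\<lambda>r. emeasure m {x} \<le> emeasure m (mball_of X x r) / ennreal (r powr N))
      (at_right 0)"
    by (intro eventually_at_rightI[of 0 1]) auto
  then have "emeasure m {x} \<le> upper_density X m N x"
    unfolding upper_density_def by (intro le_Limsup) auto
  with assms(3) show ?thesis by (rule less_le_trans)
qed

text \<open>Each property that holds eventually in \<open>F\<close> holds eventually along
  \<open>g\<close>, so the supremum of \<open>f\<close> over it bounds the limit along
  \<open>g\<close>. This allows \<lambda> to be tested on one sequence only.\<close>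

lemma Limsup_eq_top_along:
  fixes f :: "'b \<Rightarrow> ennreal"
  assumes "filterlim g F sequentially" and "(\<lambda>k. f (g k)) \<longlonglongrightarrow> \<infinity>"
  shows "Limsup F f = \<infinity>"
proof -
  have "\<infinity> \<le> Limsup F f"
    unfolding Limsup_def
  proof (rule INF_greatest)
    fix P assume "P \<in> {P. eventually P F}"
    then have "eventually (\<lambda>k. P (g k)) sequentially"
      using assms(1) by (auto simp: filterlim_iff)
    then have "eventually (\<lambda>k. f (g k) \<le> Sup (f ` Collect P)) sequentially"
      by eventually_elim (auto intro: SUP_upper)
    with assms(2) show "\<infinity> \<le> Sup (f ` Collect P)"
      by (intro tendsto_upperbound) auto
  qed
  then show ?thesis by (simp add: top_unique)
qed

section \<open>The space of pairs\<close>

text \<open>The factor 1/2 keeps both points of a pair in one unit interval, so the floor recovers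
  the index. The ratio 1/8 is chosen to beat the product of the two masses, which is
  \<open>(1/4) ^ k\<close>.\<close>

definition gap :: "nat \<Rightarrow> real" where
  "gap k = (1/8) ^ k / 2"

definition gap_set :: "real set" where
  "gap_set = range real \<union> range (\<lambda>k. real k + gap k)"

text \<open>The cap at 1 makes the whole space bounded, hence every support too. It leaves the
  distance within a pair unchanged.\<close>

definition gap_metric :: "real metric" where
  "gap_metric = capped_metric 1 (submetric euclidean_metric gap_set)"

definition gap_weight :: "real \<Rightarrow> ennreal" where
  "gap_weight x = ennreal ((1/2) ^ nat \<lfloor>x\<rfloor>)"

definition gap_measure :: "real measure" where
  "gap_measure = density (count_space gap_set) gap_weight"

section \<open>Distances, completeness and topology of the space of pairs\<close>

lemma gap_pos: "0 < gap k"
  by (simp add: gap_def)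

lemma gap_le_half: "gap k \<le> 1/2"
  by (simp add: gap_def power_le_one)

lemma floor_pair: "\<lfloor>real k + gap k\<rfloor> = int k"
  using gap_pos[of k] gap_le_half[of k] by (intro floor_unique) auto

lemma gap_setE:
  assumes "x \<in> gap_set"
  obtains k where "x = real k \<or> x = real k + gap k" "\<lfloor>x\<rfloor> = int k"
  using assms unfolding gap_set_def by (auto simp: floor_pair)

text \<open>Points of different pairs have integer parts at least 1 apart and fractional parts in
  \<open>{0..1/2}\<close>, so their distance is at least 1/2 and dominates the difference of the
  fractional parts.\<close>

lemma gap_set_cases:
  assumes "x \<in> gap_set" and "y \<in> gap_set"
  obtains (eq) "x = y"
  | (pair) k where "x = real k" "y = real k + gap k"
  | (pair') k where "y = real k" "x = real k + gap k"
  | (far) "1/2 \<le> \<bar>x - y\<bar>" "\<bar>frac x - frac y\<bar> \<le> 1/2" "\<lfloor>x\<rfloor> \<noteq> \<lfloor>y\<rfloor>"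
proof -
  obtain j where j: "x = real j \<or> x = real j + gap j" "\<lfloor>x\<rfloor> = int j"
    using assms(1) by (rule gap_setE)
  obtain k where k: "y = real k \<or> y = real k + gap k" "\<lfloor>y\<rfloor> = int k"
    using assms(2) by (rule gap_setE)
  show thesis
  proof (cases "j = k")
    case True
    then show ?thesis using j k that(1-3) by blast
  next
    case False
    then have "1 \<le> \<bar>real j - real k\<bar>" by linarith
    moreover have "x = real j + frac x" "y = real k + frac y"
      using j k by (simp_all add: frac_def)
    moreover have "frac x \<in> {0..1/2}" "frac y \<in> {0..1/2}"
      using j k gap_pos[of j] gap_pos[of k] gap_le_half[of j] gap_le_half[of k]
      by (auto simp: frac_def floor_pair)
    ultimately have "1/2 \<le> \<bar>x - y\<bar>" "\<bar>frac x - frac y\<bar> \<le> 1/2"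
      unfolding atLeastAtMost_iff by linarith+
    then show ?thesis using False j k that(4) by auto
  qed
qed

lemma real_in_gap_set: "real k \<in> gap_set"
  by (simp add: gap_set_def)

text \<open>The left and the right points are each uniformly separated, by 1 and by 1/2. Their union
  is not, as the gaps tend to 0, so closedness is proved for each half.\<close>

lemma closed_gap_set: "closed gap_set"
proof -
  have "closed (range real)"
    by (rule discrete_imp_closed[of 1]) (auto simp: dist_real_def)
  moreover have "closed (range (\<lambda>k. real k + gap k))"
  proof (rule discrete_imp_closed[of "1/2"]; clarsimp simp: dist_real_def)
    fix j k assume *: "\<bar>real k + gap k - (real j + gap j)\<bar> * 2 < 1"
    have "k = j"
    proof (rule ccontr)
      assume "k \<noteq> j"
      then have "1 \<le> \<bar>real k - real j\<bar>" by linarith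
      with * show False
        using gap_pos[of j] gap_pos[of k] gap_le_half[of j] gap_le_half[of k]
        by (auto simp: abs_if split: if_splits)
    qed
    then show "real k + gap k = real j + gap j" by simp
  qed
  ultimately show ?thesis unfolding gap_set_def by (rule closed_Un)
qed

lemma countable_gap_set: "countable gap_set"
  by (simp add: gap_set_def)

lemma mspace_gap_metric [simp]: "mspace gap_metric = gap_set"
  by (simp add: gap_metric_def)

lemma mdist_gap_metric: "mdist gap_metric x y = min 1 \<bar>x - y\<bar>"
  by (simp add: gap_metric_def capped_metric_mdist dist_real_def)

text \<open>The partner of \<open>x\<close> lies at distance exactly equal to the radius and is
  excluded because the ball is open; all other points are at distance at least 1/2, which the radius
  never exceeds.\<close>

lemma mball_of_gap_metric:
  assumes "x \<in> gap_set"
  shows "mball_of gap_metric x (gap (nat \<lfloor>x\<rfloor>)) = {x}"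
proof -
  have "y = x" if "y \<in> gap_set" "min 1 \<bar>x - y\<bar> < gap (nat \<lfloor>x\<rfloor>)" for y
    using assms that(1)
    by (cases rule: gap_set_cases)
      (use that(2) gap_le_half[of "nat \<lfloor>x\<rfloor>"] in \<open>auto simp: floor_pair min_def split: if_splits\<close>)
  then show ?thesis
    using assms gap_pos by (auto simp: in_mball_of mdist_gap_metric)
qed

text \<open>A closed subset of the reals is complete, and capping the distance preserves
  completeness.\<close>

lemma mcomplete_gap_metric: "mcomplete_of gap_metric"
proof -
  interpret Submetric UNIV "dist :: real \<Rightarrow> real \<Rightarrow> real" gap_set
    by (simp add: Met_TC.Metric_space_axioms Submetric_axioms_def Submetric_def)
  have "sub.mcomplete"
    using closed_gap_set closedin_mcomplete_imp_mcomplete complete_UNIV by simp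
  then have "Metric_space.mcomplete gap_set (sub.capped_dist 1)"
    by (simp add: sub.mcomplete_capped_metric)
  moreover have "mdist gap_metric = sub.capped_dist 1"
    by (auto simp: fun_eq_iff mdist_gap_metric sub.capped_dist_def dist_real_def)
  ultimately show ?thesis by (simp add: mcomplete_of_def)
qed

lemma mtopology_gap_metric: "mtopology_of gap_metric = discrete_topology gap_set"
proof -
  have "mtopology_of gap_metric = discrete_topology (mspace gap_metric)"
    by (rule mtopology_of_eq_discrete_topology) (use mball_of_gap_metric gap_pos in auto)
  then show ?thesis by simp
qed

section \<open>The measure: atoms and total mass\<close>

lemma sets_gap_measure [simp]: "sets gap_measure = Pow gap_set"
  by (simp add: gap_measure_def)

lemma space_gap_measure [simp]: "space gap_measure = gap_set"
  by (simp add: gap_measure_def)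

lemma emeasure_gap_measure_singleton:
  assumes "x \<in> gap_set"
  shows "emeasure gap_measure {x} = gap_weight x"
proof -
  have "emeasure gap_measure {x}
      = (\<integral>\<^sup>+ y. gap_weight y * indicator {x} y \<partial>count_space gap_set)"
    using assms unfolding gap_measure_def by (subst emeasure_density) auto
  then show ?thesis using assms by simp
qed

lemma emeasure_gap_measure_singletons:
  "emeasure gap_measure {real k} = ennreal ((1/2) ^ k)"
  "emeasure gap_measure {real k + gap k} = ennreal ((1/2) ^ k)"
  by (auto simp: gap_set_def emeasure_gap_measure_singleton gap_weight_def floor_pair)

text \<open>The pairs cover the space, and their masses are dominated by a geometric series.\<close>

lemma finite_measure_gap_measure: "finite_measure gap_measure"
proof -
  define A where "A k = {real k, real k + gap k}" for k
  have A: "A k \<in> sets gap_measure" for k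
    by (auto simp: A_def gap_set_def)
  have le: "emeasure gap_measure (A k) \<le> ennreal (2 * (1/2) ^ k)" for k
  proof -
    have "emeasure gap_measure (A k)
        \<le> emeasure gap_measure {real k} + emeasure gap_measure {real k + gap k}"
      using emeasure_subadditive[of "{real k}" gap_measure "{real k + gap k}"]
      by (auto simp: A_def gap_set_def insert_commute)
    also have "\<dots> = ennreal (2 * (1/2) ^ k)"
      by (simp add: emeasure_gap_measure_singletons flip: ennreal_plus)
    finally show ?thesis .
  qed
  have "gap_set = (\<Union>k. A k)"
    by (auto simp: A_def gap_set_def)
  then have "emeasure gap_measure gap_set \<le> (\<Sum>k. emeasure gap_measure (A k))"
    using A emeasure_subadditive_countably[of A gap_measure] by auto
  also have "\<dots> \<le> (\<Sum>k. ennreal (2 * (1/2) ^ k))"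
    using le by (intro suminf_le) auto
  also have "\<dots> = ennreal (\<Sum>k. 2 * (1/2) ^ k)"
    by (intro suminf_ennreal2 summable_mult summable_geometric) auto
  finally have "emeasure gap_measure gap_set \<noteq> top"
    by (rule neq_top_trans[OF ennreal_neq_top])
  then show ?thesis by (intro finite_measureI) simp
qed

text \<open>On \<open>gap_set\<close> the function \<open>frac\<close> is 0 at \<open>real k\<close>
  and \<open>gap k\<close> at its partner, so it serves as the function u. The Lipschitz constant is
  1: within a pair the increment equals the distance, and across pairs it is at most 1/2, which the
  distance is not below.\<close>

lemma lipschitz_bounded_support_frac: "lipschitz_bounded_support gap_metric frac"
proof -
  interpret Metric_space gap_set "mdist gap_metric"
    using Metric_space_mspace_mdist[of gap_metric] by simp
  have "\<bar>frac x - frac y\<bar> \<le> min 1 \<bar>x - y\<bar>" if "x \<in> gap_set" "y \<in> gap_set" for x y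
    using that
  proof (cases rule: gap_set_cases)
    case (pair k)
    then show ?thesis using gap_pos[of k] gap_le_half[of k] by (simp add: frac_def floor_pair)
  next
    case (pair' k)
    then show ?thesis using gap_pos[of k] gap_le_half[of k] by (simp add: frac_def floor_pair)
  qed auto
  then have "lipschitz_fun gap_metric frac"
    by (auto simp: Lipschitz_continuous_map_def mdist_gap_metric dist_real_def intro!: exI[of _ 1])
  moreover have "mbounded (mtopology_of gap_metric closure_of {x \<in> gap_set. frac x \<noteq> 0})"
    unfolding mbounded_alt
    by (auto simp: mtopology_gap_metric mdist_gap_metric discrete_topology_closure_of intro!: exI[of _ 1])
  ultimately show ?thesis by (simp add: lipschitz_bounded_support_def)
qed

text \<open>This value of \<open>l\<close> turns the defining inequality into an equality at the
  pair: increment and distance both equal \<open>gap k\<close>, and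
  \<open>l * gap k powr (N / p + 1)\<close> collapses to \<open>gap k\<close>.\<close>

lemma pair_in_E_set:
  assumes "l = gap k powr (- (N / p))"
  shows "(real k, real k + gap k) \<in> E_set gap_metric p N frac l"
proof -
  have "l * gap k powr (N / p + 1) = gap k"
    using gap_pos[of k] by (simp add: assms flip: powr_add)
  then show ?thesis
    using gap_pos[of k] gap_le_half[of k]
    by (auto simp: E_set_def gap_set_def mdist_gap_metric frac_def floor_pair)
qed

lemma emeasure_E_set_ge:
  assumes "l = gap k powr (- (N / p))"
  shows "ennreal ((1/4) ^ k)
    \<le> emeasure (gap_measure \<Otimes>\<^sub>M gap_measure) (E_set gap_metric p N frac l)"
proof -
  interpret finite_measure gap_measure by (rule finite_measure_gap_measure)
  let ?E = "E_set gap_metric p N frac l"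
  have E: "?E \<subseteq> gap_set \<times> gap_set"
    by (auto simp: E_set_def)
  \<comment> \<open>Measurability matters here, since \<open>emeasure\<close> is 0 outside the
    sigma-algebra. It follows from countability, as singletons are measurable rectangles.\<close>
  then have "countable ?E"
    using countable_gap_set by (meson countable_SIGMA countable_subset)
  moreover have "{z} \<in> sets (gap_measure \<Otimes>\<^sub>M gap_measure)" if "z \<in> ?E" for z
  proof -
    have "{fst z} \<times> {snd z} \<in> sets (gap_measure \<Otimes>\<^sub>M gap_measure)"
      using that E by (intro pair_measureI) auto
    then show ?thesis by simp
  qed
  ultimately have Es: "?E \<in> sets (gap_measure \<Otimes>\<^sub>M gap_measure)"
    using sets.countable by blast
  have "(1/4 :: real) ^ k = (1/2) ^ k * (1/2) ^ k"
    unfolding power_mult_distrib[symmetric] by simp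
  then have "ennreal ((1/4) ^ k) = ennreal ((1/2) ^ k * (1/2) ^ k)"
    by (rule arg_cong)
  also have "\<dots> = emeasure gap_measure {real k} * emeasure gap_measure {real k + gap k}"
    by (simp add: emeasure_gap_measure_singletons ennreal_mult)
  also have "\<dots> = emeasure (gap_measure \<Otimes>\<^sub>M gap_measure) ({real k} \<times> {real k + gap k})"
    by (intro emeasure_pair_measure_Times[symmetric]) (auto simp: gap_set_def)
  also have "\<dots> \<le> emeasure (gap_measure \<Otimes>\<^sub>M gap_measure) ?E"
    using pair_in_E_set[OF assms] Es by (intro emeasure_mono) auto
  finally show ?thesis .
qed

section \<open>Divergence along the sequence of gaps\<close>

lemma filterlim_gap: "filterlim gap (at_right 0) sequentially"
proof -
  have "(\<lambda>k. (1/8 :: real) ^ k / 2) \<longlonglongrightarrow> 0 / 2"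
    by (intro tendsto_intros LIMSEQ_realpow_zero) auto
  then have "gap \<longlonglongrightarrow> 0"
    by (simp add: gap_def[abs_def])
  then show ?thesis
    using gap_pos by (simp add: filterlim_at less_imp_neq[symmetric])
qed

lemma Limsup_E_set_pair:
  fixes p N :: real
  assumes "p \<ge> 1" and "N \<ge> 1"
  shows "Limsup at_top (\<lambda>l :: real. ennreal (l powr p)
    * emeasure (gap_measure \<Otimes>\<^sub>M gap_measure) (E_set gap_metric p N frac l)) = \<infinity>"
proof (rule Limsup_eq_top_along)
  let ?l = "\<lambda>k. gap k powr (- (N / p))"
  have "filterlim (\<lambda>k. gap k powr (N / p)) (at_right 0) sequentially"
  proof -
    \<comment> \<open>The base tends to 0, where continuity of \<open>powr\<close> relies on the
      positive exponent and the non-negative bases.\<close>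
    have "(\<lambda>k. gap k powr (N / p)) \<longlonglongrightarrow> 0 powr (N / p)"
      using filterlim_gap assms gap_pos
      by (intro tendsto_powr') (auto simp: filterlim_at less_imp_le)
    then show ?thesis
      using gap_pos by (simp add: filterlim_at less_imp_neq[symmetric])
  qed
  then show "filterlim ?l at_top sequentially"
    unfolding powr_minus by (rule filterlim_compose[OF filterlim_inverse_at_top_right])
  have ge: "ennreal (2 ^ k) \<le> ennreal (?l k powr p)
      * emeasure (gap_measure \<Otimes>\<^sub>M gap_measure) (E_set gap_metric p N frac (?l k))" for k
  proof -
    \<comment> \<open>For a base at most 1, \<open>powr\<close> decreases in the exponent, so
      \<open>N \<ge> 1\<close> leaves the bound \<open>2 * 8 ^ k\<close>; multiplied by
      \<open>(1/4) ^ k\<close> it is at least \<open>2 ^ k\<close>, uniformly in \<open>p\<close>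
      and \<open>N\<close>.\<close>
    have "gap k powr -1 \<le> gap k powr (-N)"
      using assms gap_pos[of k] gap_le_half[of k] by (intro powr_mono') auto
    moreover have "gap k powr -1 = 2 * 8 ^ k"
      using gap_pos[of k] by (simp add: powr_minus gap_def power_divide)
    moreover have "?l k powr p = gap k powr (-N)"
      using assms by (simp add: powr_powr)
    ultimately have "2 * 8 ^ k * (1/4) ^ k \<le> ?l k powr p * (1/4) ^ k"
      by (intro mult_right_mono) auto
    moreover have "(8 :: real) ^ k * (1/4) ^ k = 2 ^ k"
      unfolding power_mult_distrib[symmetric] by simp
    ultimately have "2 ^ k \<le> ?l k powr p * (1/4) ^ k"
      using zero_le_power[of "2 :: real" k] by linarith
    then have "ennreal (2 ^ k) \<le> ennreal (?l k powr p) * ennreal ((1/4) ^ k)"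
      by (simp add: ennreal_leI flip: ennreal_mult)
    also have "\<dots> \<le> ennreal (?l k powr p)
      * emeasure (gap_measure \<Otimes>\<^sub>M gap_measure) (E_set gap_metric p N frac (?l k))"
      by (intro mult_left_mono emeasure_E_set_ge) auto
    finally show ?thesis .
  qed
  have lim: "(\<lambda>k. ennreal (2 ^ k)) \<longlonglongrightarrow> \<infinity>"
    using filterlim_at_infinity_imp_filterlim_at_top[OF filterlim_realpow_sequentially_gt1[of "2 :: real"]]
    by (simp add: ennreal_tendsto_top_eq_at_top)
  show "(\<lambda>k. ennreal (?l k powr p)
      * emeasure (gap_measure \<Otimes>\<^sub>M gap_measure) (E_set gap_metric p N frac (?l k))) \<longlonglongrightarrow> \<infinity>"
    by (rule tendsto_sandwich[OF _ _ lim tendsto_const]) (simp_all add: ge del: ennreal_power)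
qed

theorem mainTheorem6:
  fixes p N :: real
  assumes "p \<ge> 1" and "N \<ge> 1"
  shows "\<exists>(X :: real metric) (m :: real measure) (u :: real \<Rightarrow> real).
    lipschitz_differentiability_space X m \<and>
    (AE x in m. 0 < upper_density X m N x) \<and>
    lipschitz_bounded_support X u \<and>
    Limsup at_top (\<lambda>l :: real. ennreal (l powr p) * emeasure (m \<Otimes>\<^sub>M m) (E_set X p N u l)) = \<infinity> \<and>
    (\<integral>\<^sup>+ x. upper_density X m N x * ennreal_powr (pointwise_lip X u x) p \<partial>m) < \<infinity>"
proof (intro exI conjI)
  interpret finite_measure gap_measure by (rule finite_measure_gap_measure)
  have pos: "0 < emeasure gap_measure {x}" if "x \<in> gap_set" for x
    using that by (simp add: emeasure_gap_measure_singleton gap_weight_def)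
  have "metric_measure_space gap_metric gap_measure"
    by (rule discrete_metric_measure_space)
      (use pos emeasure_finite[of gap_set] mcomplete_gap_metric countable_gap_set real_in_gap_set in
        \<open>auto simp: mtopology_gap_metric less_top[symmetric]\<close>)
  then show "lipschitz_differentiability_space gap_metric gap_measure"
    by (rule discrete_lipschitz_differentiability_space) (simp add: mtopology_gap_metric)
  show "AE x in gap_measure. 0 < upper_density gap_metric gap_measure N x"
    using pos assms by (intro AE_I2 upper_density_pos_atom) auto
  show "lipschitz_bounded_support gap_metric frac"
    by (rule lipschitz_bounded_support_frac)
  show "Limsup at_top (\<lambda>l :: real. ennreal (l powr p)
      * emeasure (gap_measure \<Otimes>\<^sub>M gap_measure) (E_set gap_metric p N frac l)) = \<infinity>"
    using assms by (rule Limsup_E_set_pair)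
  have "pointwise_lip gap_metric frac x = 0" if "x \<in> gap_set" for x
    using pointwise_lip_isolated[OF gap_pos mball_of_gap_metric[OF that]] .
  \<comment> \<open>\<open>ennreal_powr 0 p\<close> is 0, and in \<open>ennreal\<close> the product
    of 0 with \<infinity> is 0, so the integrand vanishes even where the upper density is
    infinite.\<close>
  then have "(\<integral>\<^sup>+ x. upper_density gap_metric gap_measure N x
      * ennreal_powr (pointwise_lip gap_metric frac x) p \<partial>gap_measure) = (\<integral>\<^sup>+ x. 0 \<partial>gap_measure)"
    using assms by (intro nn_integral_cong) (simp add: ennreal_powr_def)
  then show "(\<integral>\<^sup>+ x. upper_density gap_metric gap_measure N x
      * ennreal_powr (pointwise_lip gap_metric frac x) p \<partial>gap_measure) < \<infinity>"
    by simp
qed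

end
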